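(* Set $\hbar=1$. Let $\Sigma(t)=\nu(t)\mathbb 1_2$ be a continuously differentiable one-mode radial trajectory with $\nu(t)>\frac12$. If the instantaneous Bures kinetic density $K_{\rm B}=g^{\rm B}_{\nu\nu}\dot\nu^2$ is bounded by $K_{\rm B}\le K_{\max}$, then $$|\dot\nu|\le2\sqrt{K_{\max}\left(\nu^2-\frac14\right)}\longrightarrow0\qquad\left(\nu\downarrow\tfrac12\right).$$ Thus a bounded-budget Bures trajectory must decelerate in the covariance coordinate $\nu$ on approach to the Williamson floor $\nu=\frac12$.
   Context: The radial one-mode Bures metric coefficient in units $\hbar=1$ is $g^{\rm B}_{\nu\nu}=\frac{1}{4(\nu^2-\frac14)}$ for $\nu>1/2$; $\dot\nu=d\nu/dt$, and $K_{\max}$ is a finite constant. *)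

theory Defs
  imports "HOL-Analysis.Analysis"
begin

text \<open>Units with \<open>\<hbar> = 1\<close> throughout, so that the vacuum covariance matrix is \<open>1/2\<close> times the identity.\<close>

definition radial_covariance :: "real \<Rightarrow> real^2^2" where
  "radial_covariance x = x *\<^sub>R mat 1"

text \<open>Derivatives are taken within the time interval, hence one-sided at an endpoint belonging to it.
  The library's \<open>C1_differentiable_on\<close> asks for a two-sided derivative there.\<close>

definition C1_trajectory_on :: "real set \<Rightarrow> (real \<Rightarrow> 'a::real_normed_vector) \<Rightarrow> bool" where
  "C1_trajectory_on I f \<longleftrightarrow>
     (\<exists>f'. (\<forall>t\<in>I. (f has_vector_derivative f' t) (at t within I)) \<and> continuous_on I f')"

definition velocity :: "real set \<Rightarrow> (real \<Rightarrow> real) \<Rightarrow> real \<Rightarrow> real" where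
  "velocity I \<nu> t = vector_derivative \<nu> (at t within I)"

text \<open>The coefficient of the Bures metric along the family \<open>radial_covariance x\<close> in the
  coordinate \<open>x\<close>. It is meaningful for \<open>x > 1/2\<close> only.\<close>

definition bures_coeff :: "real \<Rightarrow> real" where
  "bures_coeff x = 1 / (4 * (x\<^sup>2 - 1/4))"

definition bures_kinetic_density :: "real set \<Rightarrow> (real \<Rightarrow> real) \<Rightarrow> real \<Rightarrow> real" where
  "bures_kinetic_density I \<nu> t = bures_coeff (\<nu> t) * (velocity I \<nu> t)\<^sup>2"

end

theory Submission
  imports Defs
begin

text \<open>The Bures coefficient blows up at the floor 1/2, so a bounded kinetic density leaves
  room only for a vanishing speed. Above the floor the coefficient is positive, and the budget can
  be solved for the speed at each time (\<open>abs_le_of_bures_coeff_bound\<close>). The resulting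
  bound is continuous in the coordinate and vanishes at 1/2
  (\<open>tendsto_bures_speed_bound\<close>); squeezing does the rest.\<close>

lemma abs_le_of_bures_coeff_bound:
  assumes "x > 1/2" and "bures_coeff x * v\<^sup>2 \<le> K"
  shows "\<bar>v\<bar> \<le> 2 * sqrt (K * (x\<^sup>2 - 1/4))"
proof -
  have "(1/2)\<^sup>2 < x\<^sup>2"
    using assms(1) by (intro power_strict_mono) auto
  then have "x\<^sup>2 - 1/4 > 0"
    by (simp add: power2_eq_square)
  \<comment> \<open>Positivity of the denominator lets it be cleared without reversing the
    inequality.\<close>
  then have "v\<^sup>2 \<le> 4 * (K * (x\<^sup>2 - 1/4))"
    using assms(2) by (simp add: bures_coeff_def pos_divide_le_eq mult_ac)
  then have "sqrt (v\<^sup>2) \<le> sqrt (4 * (K * (x\<^sup>2 - 1/4)))"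
    by (rule real_sqrt_le_mono)
  then show ?thesis
    by (simp add: real_sqrt_mult)
qed

text \<open>The general \<open>f\<close> and \<open>F\<close> serve two limits: the coordinate
  itself descending to 1/2, and \<open>\<nu>\<close> along a filter of times.\<close>

lemma tendsto_bures_speed_bound:
  fixes f :: "'a \<Rightarrow> real"
  assumes "(f \<longlongrightarrow> 1/2) F"
  shows "((\<lambda>t. 2 * sqrt (K * ((f t)\<^sup>2 - 1/4))) \<longlongrightarrow> 0) F"
proof -
  \<comment> \<open>\<open>sqrt\<close> is continuous on all of the reals, so the limit may be taken
    inside it for \<open>K\<close> of either sign.\<close>
  have "((\<lambda>t. 2 * sqrt (K * ((f t)\<^sup>2 - 1/4))) \<longlongrightarrow> 2 * sqrt (K * ((1/2)\<^sup>2 - 1/4))) F"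
    by (intro tendsto_intros assms)
  then show ?thesis
    by (simp add: power2_eq_square)
qed

theorem corollary21:
  fixes I :: "real set" and \<Sigma> :: "real \<Rightarrow> real^2^2" and \<nu> :: "real \<Rightarrow> real" and K_max :: real
  assumes "is_interval I" and "interior I \<noteq> {}"
    and "C1_trajectory_on I \<Sigma>"
    and "\<And>t. t \<in> I \<Longrightarrow> \<Sigma> t = radial_covariance (\<nu> t)"
    and "\<And>t. t \<in> I \<Longrightarrow> \<nu> t > 1/2"
    and "\<And>t. t \<in> I \<Longrightarrow> bures_kinetic_density I \<nu> t \<le> K_max"
  shows "(\<forall>t\<in>I. \<bar>velocity I \<nu> t\<bar> \<le> 2 * sqrt (K_max * ((\<nu> t)\<^sup>2 - 1/4)))
    \<and> ((\<lambda>x. 2 * sqrt (K_max * (x\<^sup>2 - 1/4))) \<longlongrightarrow> 0) (at_right (1/2))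
    \<and> (\<forall>F. (\<forall>\<^sub>F t in F. t \<in> I) \<longrightarrow> (\<nu> \<longlongrightarrow> 1/2) F \<longrightarrow> (velocity I \<nu> \<longlongrightarrow> 0) F)"
proof (intro conjI allI impI)
  show bound: "\<forall>t\<in>I. \<bar>velocity I \<nu> t\<bar> \<le> 2 * sqrt (K_max * ((\<nu> t)\<^sup>2 - 1/4))"
    using assms(5,6) by (auto simp: bures_kinetic_density_def intro: abs_le_of_bures_coeff_bound)
  show "((\<lambda>x. 2 * sqrt (K_max * (x\<^sup>2 - 1/4))) \<longlongrightarrow> 0) (at_right (1/2))"
    by (intro tendsto_bures_speed_bound tendsto_ident_at)
  \<comment> \<open>\<open>F\<close> can express times tending to an endpoint of \<open>I\<close>
    or, if \<open>I\<close> is unbounded, to infinity. Staying in \<open>I\<close> eventually makes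
    the pointwise bound available for the squeeze.\<close>
  fix F assume "\<forall>\<^sub>F t in F. t \<in> I" and "(\<nu> \<longlongrightarrow> 1/2) F"
  from this(1) have "\<forall>\<^sub>F t in F. norm (velocity I \<nu> t) \<le> 2 * sqrt (K_max * ((\<nu> t)\<^sup>2 - 1/4))"
    by eventually_elim (use bound in auto)
  then show "(velocity I \<nu> \<longlongrightarrow> 0) F"
    by (rule Lim_null_comparison) (rule tendsto_bures_speed_bound, fact)
qed

end
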